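(* Let $X$ be a complete, locally convex median space with compact intervals. Then the identity map of $X$ extends to a homeomorphism between the Roller compactification $\overline X$ and the Busemann (horofunction) compactification of $X$; that is, for $x_0\in X$ there is a homeomorphism $\Phi\colon\overline X\to\overline{B_{x_0}(X)}$ with $\Phi(x)=B_{x_0}(x)$ for all $x\in X\subseteq\overline X$.
   Context: A metric space $(X,d)$ is a median space if for all $x,y,z\in X$ there is a unique point $m(x,y,z)$ lying in $I(x,y)\cap I(y,z)\cap I(z,x)$, where $I(x,y)=\{z\in X\mid d(x,y)=d(x,z)+d(z,y)\}$. $X$ has compact intervals if each $I(x,y)$ is compact. A subset $C\subseteq X$ is convex if $I(x,y)\subseteq C$ for all $x,y\in C$; $X$ is locally convex if every point has a basis of convex neighbourhoods. Roller compactification. Let $\mathcal{J}$ be the set of all intervals $I=I(x,y)$ of $X$ (singletons allowed); for $I=I(x,y)$ let $\pi_I\colon X\to I$, $\pi_I(z)=m(x,y,z)$. A nonempty intersection of two intervals is an interval. Put $$\overline X=\Big\{(x_I)_I\in\prod_{I\in\mathcal{J}}I\ \Big|\ \pi_{I\cap J}(x_I)=\pi_{I\cap J}(x_J)\ \ \forall I,J\in\mathcal{J},\ I\cap J\neq\emptyset\Big\},$$ with the subspace topology of the product topology (each $I$ having its metric topology); $X$ is identified, as a set, with its image under the injection $x\mapsto(\pi_I(x))_I$. Busemann compactification. For $x_0\in X$, let $\mathcal{C}_{Lip}(X)_{x_0}$ be the set of $1$-Lipschitz functions $X\to\mathbb{R}$ taking $x_0$ to $0$, with the topology of pointwise convergence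 (it is compact). Let $B_{x_0}\colon X\to\mathcal{C}_{Lip}(X)_{x_0}$, $B_{x_0}(x)=d(x,\cdot)-d(x,x_0)$. The Busemann (horofunction) compactification of $X$ is the closure $\overline{B_{x_0}(X)}$ in $\mathcal{C}_{Lip}(X)_{x_0}$; up to canonical homeomorphism it does not depend on $x_0$. *)

theory Defs
  imports "HOL-Analysis.Analysis"
begin

section \<open>Median spaces\<close>

definition metric_interval :: "'a::metric_space \<Rightarrow> 'a \<Rightarrow> 'a set" where
  "metric_interval x y = {z. dist x y = dist x z + dist z y}"

class median_space = metric_space +
  assumes unique_median:
    "\<exists>!m. m \<in> metric_interval x y \<inter> metric_interval y z \<inter> metric_interval z x"

definition median :: "'a::median_space \<Rightarrow> 'a \<Rightarrow> 'a \<Rightarrow> 'a" where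
  "median x y z =
     (THE m. m \<in> metric_interval x y \<inter> metric_interval y z \<inter> metric_interval z x)"

definition interval_convex :: "'a::metric_space set \<Rightarrow> bool" where
  "interval_convex C \<longleftrightarrow> (\<forall>x\<in>C. \<forall>y\<in>C. metric_interval x y \<subseteq> C)"

text \<open>Neighbourhoods need not be open.\<close>

definition locally_interval_convex :: "'a::metric_space itself \<Rightarrow> bool" where
  "locally_interval_convex _ \<longleftrightarrow>
     (\<forall>(x::'a) U. open U \<longrightarrow> x \<in> U \<longrightarrow> (\<exists>C. interval_convex C \<and> x \<in> interior C \<and> C \<subseteq> U))"

definition compact_intervals :: "'a::metric_space itself \<Rightarrow> bool" where
  "compact_intervals _ \<longleftrightarrow> (\<forall>x y::'a. compact (metric_interval x y))"

section \<open>The Roller compactification\<close>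

definition intervals :: "'a::metric_space set set" where
  "intervals = {metric_interval x y | x y. True}"

text \<open>The point \<open>median x y z\<close> depends on \<open>x\<close> and \<open>y\<close> only through the interval
  between them: it is the unique point of that interval lying in \<open>metric_interval z w\<close> for
  every \<open>w\<close> in the interval. Hence the description below determines the value for all
  \<open>I \<in> intervals\<close>; other arguments are irrelevant.\<close>

definition interval_proj :: "'a::median_space set \<Rightarrow> 'a \<Rightarrow> 'a" where
  "interval_proj I z = (THE p. \<exists>x y. I = metric_interval x y \<and> p = median x y z)"

definition roller_points :: "('a::median_space set \<Rightarrow> 'a) set" where
  "roller_points =
     {\<xi> \<in> (\<Pi>\<^sub>E I\<in>intervals. I).
        \<forall>I\<in>intervals. \<forall>J\<in>intervals. I \<inter> J \<noteq> {} \<longrightarrow>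
          interval_proj (I \<inter> J) (\<xi> I) = interval_proj (I \<inter> J) (\<xi> J)}"

definition roller_compactification :: "('a::median_space set \<Rightarrow> 'a) topology" where
  "roller_compactification =
     subtopology (product_topology (\<lambda>I. top_of_set I) intervals) roller_points"

definition roller_embedding :: "'a::median_space \<Rightarrow> 'a set \<Rightarrow> 'a" where
  "roller_embedding x = (\<lambda>I\<in>intervals. interval_proj I x)"

section \<open>The Busemann compactification\<close>

definition lip_functions :: "'a::metric_space \<Rightarrow> ('a \<Rightarrow> real) set" where
  "lip_functions x\<^sub>0 = {f. 1-lipschitz_on UNIV f \<and> f x\<^sub>0 = 0}"

definition lip_topology :: "'a::metric_space \<Rightarrow> ('a \<Rightarrow> real) topology" where
  "lip_topology x\<^sub>0 =
     subtopology (product_topology (\<lambda>_. euclideanreal) UNIV) (lip_functions x\<^sub>0)"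

definition busemann_embedding :: "'a::metric_space \<Rightarrow> 'a \<Rightarrow> 'a \<Rightarrow> real" where
  "busemann_embedding x\<^sub>0 x = (\<lambda>y. dist x y - dist x x\<^sub>0)"

definition busemann_compactification :: "'a::metric_space \<Rightarrow> ('a \<Rightarrow> real) topology" where
  "busemann_compactification x\<^sub>0 =
     subtopology (lip_topology x\<^sub>0) (lip_topology x\<^sub>0 closure_of range (busemann_embedding x\<^sub>0))"

end

theory Submission
  imports Defs
begin

text \<open>
  Intervals of a median space are gated: \<open>median x y z\<close> lies between \<open>z\<close> and every point of
  \<open>metric_interval x y\<close>. For a Roller point \<open>\<xi>\<close> and two intervals \<open>I\<close>, \<open>J\<close>, the coordinate of \<open>\<xi>\<close>
  at the interval between \<open>\<xi> I\<close> and \<open>\<xi> J\<close> is a point of the space that projects to both \<open>\<xi> I\<close> and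
  \<open>\<xi> J\<close>. Since fibres of gate projections are convex, Helly's theorem yields for finitely many
  intervals one point that realises all these coordinates of \<open>\<xi>\<close>. In particular the space is dense
  in its Roller compactification.

  The map \<open>\<Phi> \<xi> y = dist p y - dist p x\<^sub>0\<close>, where \<open>p\<close> is the coordinate of \<open>\<xi>\<close> at the interval
  between \<open>x\<^sub>0\<close> and \<open>y\<close>, is continuous and extends the Busemann embedding. If \<open>p = \<xi> I\<close> and
  \<open>q = \<eta> I\<close>, then \<open>\<Phi> \<xi> q - \<Phi> \<xi> p = dist p q\<close> and \<open>\<Phi> \<eta> p - \<Phi> \<eta> q = dist p q\<close>, so \<open>\<Phi>\<close> is
  injective. As the Roller compactification is compact, \<open>\<Phi>\<close> is a homeomorphism onto a closed set
  in which the Busemann embedding has dense image.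
\<close>

section \<open>Gates in median spaces\<close>

lemma metric_interval_iff: "z \<in> metric_interval x y \<longleftrightarrow> dist x y = dist x z + dist z y"
  by (simp add: metric_interval_def)

lemma metric_interval_sym: "metric_interval x y = metric_interval y x"
  by (auto simp: metric_interval_iff dist_commute)

lemma left_in_metric_interval [simp]: "x \<in> metric_interval x y"
  and right_in_metric_interval [simp]: "y \<in> metric_interval x y"
  by (simp_all add: metric_interval_iff)

lemma metric_interval_self [simp]: "metric_interval x x = {x}"
  by (auto simp: metric_interval_iff dist_commute)

lemma metric_interval_trans:
  assumes "w \<in> metric_interval x y" "y \<in> metric_interval x z"
  shows "w \<in> metric_interval x z" "y \<in> metric_interval w z"
  using assms dist_triangle[of x z w] dist_triangle[of w z y]
  unfolding metric_interval_iff by linarith+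

lemma metric_interval_antisym:
  assumes "p \<in> metric_interval z q" "q \<in> metric_interval z p"
  shows "p = q"
  using assms by (simp add: metric_interval_iff dist_commute)

lemma median_unique:
  fixes x y z :: "'a::median_space"
  assumes "m \<in> metric_interval x y" "m \<in> metric_interval y z" "m \<in> metric_interval z x"
  shows "median x y z = m"
  unfolding median_def using assms by (intro the1_equality unique_median) auto

lemma median_in_intervals:
  fixes x y z :: "'a::median_space"
  shows "median x y z \<in> metric_interval x y"
    "median x y z \<in> metric_interval y z"
    "median x y z \<in> metric_interval z x"
  using theI'[OF unique_median[of x y z]] unfolding median_def by auto

text \<open>The gate of the theory of gated sets, stated as a relation so that it applies to a set
  before gates are known to exist there.\<close>

definition is_gate :: "'a::metric_space set \<Rightarrow> 'a \<Rightarrow> 'a \<Rightarrow> bool" where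
  "is_gate I z p \<longleftrightarrow> p \<in> I \<and> (\<forall>w\<in>I. p \<in> metric_interval z w)"

lemma is_gate_unique: "is_gate I z p \<Longrightarrow> is_gate I z q \<Longrightarrow> p = q"
  unfolding is_gate_def by (blast intro: metric_interval_antisym)

text \<open>The median of \<open>z\<close> and the two points \<open>median a w z\<close>, \<open>median b w z\<close> is again
  \<open>median a b z\<close>, and it visibly lies between \<open>z\<close> and \<open>w\<close>.\<close>

lemma is_gate_median:
  fixes a b z :: "'a::median_space"
  shows "is_gate (metric_interval a b) z (median a b z)"
  unfolding is_gate_def
proof (intro conjI ballI median_in_intervals)
  fix w assume w: "w \<in> metric_interval a b"
  define u where "u = median a w z"
  define v where "v = median b w z"
  define n where "n = median u v z"
  have u: "u \<in> metric_interval a w" "u \<in> metric_interval z w" "u \<in> metric_interval z a"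
    using median_in_intervals[of a w z] by (auto simp: u_def metric_interval_sym)
  have v: "v \<in> metric_interval b w" "v \<in> metric_interval z w" "v \<in> metric_interval z b"
    using median_in_intervals[of b w z] by (auto simp: v_def metric_interval_sym)
  have n: "n \<in> metric_interval u v" "n \<in> metric_interval z v" "n \<in> metric_interval z u"
    using median_in_intervals[of u v z] by (auto simp: n_def metric_interval_sym)
  have wu: "w \<in> metric_interval u b"
    using metric_interval_trans(2)[OF u(1) w] .
  have vub: "v \<in> metric_interval b u"
    using metric_interval_trans(1)[OF v(1), of u] wu metric_interval_sym[of b u] by simp
  have "n \<in> metric_interval u b"
    using metric_interval_trans(1)[OF n(1), of b] vub metric_interval_sym[of b u] by simp
  moreover have "u \<in> metric_interval a b"
    using metric_interval_trans(1)[OF u(1) w] .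
  ultimately have "n \<in> metric_interval a b"
    using metric_interval_trans(1)[of n b u a] metric_interval_sym[of b u]
      metric_interval_sym[of b a] by simp
  moreover have "n \<in> metric_interval z a" "n \<in> metric_interval z b"
    using metric_interval_trans(1)[OF n(3) u(3)] metric_interval_trans(1)[OF n(2) v(3)] by auto
  ultimately have "median a b z = n"
    by (intro median_unique) (auto simp: metric_interval_sym)
  then show "median a b z \<in> metric_interval z w"
    using metric_interval_trans(1)[OF n(3) u(2)] by simp
qed

lemma is_gate_dist: "is_gate I z p \<Longrightarrow> w \<in> I \<Longrightarrow> dist z w = dist z p + dist p w"
  unfolding is_gate_def metric_interval_iff by blast

lemma is_gate_in: "is_gate I z p \<Longrightarrow> p \<in> I"
  by (simp add: is_gate_def)

lemma is_gate_self: "z \<in> I \<Longrightarrow> is_gate I z z"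
  by (simp add: is_gate_def)

lemma is_gate_trans:
  assumes "is_gate I x p" "is_gate K p q" "K \<subseteq> I"
  shows "is_gate K x q"
  unfolding is_gate_def
proof (intro conjI ballI)
  show "q \<in> K" using assms(2) by (simp add: is_gate_def)
  fix w assume "w \<in> K"
  then have "q \<in> metric_interval w p" "p \<in> metric_interval w x"
    using assms by (auto simp: is_gate_def metric_interval_sym)
  then show "q \<in> metric_interval x w"
    using metric_interval_trans(1)[of q w p x] metric_interval_sym[of w x] by simp
qed

text \<open>Add the two gate equalities and bound their left sides by the triangle inequality:
  \<open>dist x p\<close> and \<open>dist y q\<close> cancel, leaving twice the claim.\<close>

lemma is_gate_lipschitz:
  assumes "is_gate I x p" "is_gate I y q"
  shows "dist p q \<le> dist x y"
proof -
  have "dist x q = dist x p + dist p q" "dist y p = dist y q + dist q p"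
    using is_gate_dist[OF assms(1) is_gate_in[OF assms(2)]]
      is_gate_dist[OF assms(2) is_gate_in[OF assms(1)]] by auto
  then show ?thesis
    using dist_triangle[of x q y] dist_triangle[of y p x] by (simp add: dist_commute)
qed

section \<open>Convex sets and their gates\<close>

lemma interval_convexD:
  "interval_convex C \<Longrightarrow> x \<in> C \<Longrightarrow> y \<in> C \<Longrightarrow> z \<in> metric_interval x y \<Longrightarrow> z \<in> C"
  unfolding interval_convex_def by blast

lemma interval_convex_Int:
  "interval_convex C \<Longrightarrow> interval_convex D \<Longrightarrow> interval_convex (C \<inter> D)"
  unfolding interval_convex_def by blast

text \<open>Going from \<open>z\<close> to \<open>x\<close> and going from \<open>z\<close> to
  \<open>y\<close> can both pass through the gate \<open>p\<close> at no cost; as \<open>z\<close>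
  is already between \<open>x\<close> and \<open>y\<close>, the detour to \<open>p\<close> must have
  length zero.\<close>

lemma interval_convex_gated:
  assumes "\<And>z. \<exists>p. is_gate C z p"
  shows "interval_convex C"
  unfolding interval_convex_def
proof (intro ballI subsetI)
  fix x y z assume xy: "x \<in> C" "y \<in> C" and z: "z \<in> metric_interval x y"
  obtain p where p: "is_gate C z p" using assms by blast
  then have "dist z x = dist z p + dist p x" "dist z y = dist z p + dist p y"
    using is_gate_dist[OF p] xy by auto
  then have "dist z p \<le> 0"
    using z dist_triangle[of x y p] by (simp add: metric_interval_iff dist_commute)
  then show "z \<in> C" using p by (simp add: is_gate_def)
qed

lemma interval_convex_metric_interval:
  fixes a b :: "'a::median_space"
  shows "interval_convex (metric_interval a b)"
  using is_gate_median by (intro interval_convex_gated) blast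

text \<open>The median \<open>s\<close> of the three gates turns out to be \<open>r\<close>. The
  lemma underlies both the convexity of fibres and the intersection of intervals.\<close>

lemma is_gate_between:
  fixes x y z :: "'a::median_space"
  assumes "interval_convex C" and gates: "is_gate C x p" "is_gate C y q" "is_gate C z r"
    and z: "z \<in> metric_interval x y"
  shows "r \<in> metric_interval p q"
proof -
  define s where "s = median p q r"
  have s: "s \<in> metric_interval p q" "s \<in> metric_interval r q" "s \<in> metric_interval r p"
    using median_in_intervals[of p q r] by (auto simp: s_def metric_interval_sym)
  have pqr: "p \<in> C" "q \<in> C" "r \<in> C" using gates by (auto simp: is_gate_def)
  have sC: "s \<in> C" using interval_convexD[OF assms(1) pqr(1,2) s(1)] .
  have "p \<in> metric_interval r x" "q \<in> metric_interval r y"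
    using gates pqr by (auto simp: is_gate_def metric_interval_sym)
  then have sx: "s \<in> metric_interval r x" and sy: "s \<in> metric_interval r y"
    using metric_interval_trans(1)[OF s(3)] metric_interval_trans(1)[OF s(2)] by auto
  \<comment> \<open>\<open>t\<close> is also the median of \<open>x\<close>, \<open>y\<close>,
    \<open>r\<close>, hence the gate of \<open>r\<close> in \<open>metric_interval x y\<close>, so
    it lies between \<open>r\<close> and \<open>z\<close>. Since \<open>s\<close> lies between
    \<open>r\<close> and \<open>t\<close>, it lies between \<open>r\<close> and \<open>z\<close>
    too.\<close>
  define t where "t = median x y s"
  have t: "t \<in> metric_interval x y" "t \<in> metric_interval y s" "t \<in> metric_interval x s"
    using median_in_intervals[of x y s] by (auto simp: t_def metric_interval_sym)
  have "t \<in> metric_interval x r" "t \<in> metric_interval y r"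
    using metric_interval_trans(1)[OF t(3), of r] metric_interval_trans(1)[OF t(2), of r] sx sy
      metric_interval_sym[of r x] metric_interval_sym[of r y] by auto
  then have "median x y r = t"
    using t(1) by (intro median_unique) (auto simp: metric_interval_sym)
  then have trz: "t \<in> metric_interval r z"
    using is_gate_median[of x y r] z by (auto simp: is_gate_def)
  have "s \<in> metric_interval t r"
    using metric_interval_trans(2)[of t x s r] t(3) sx metric_interval_sym[of r x] by simp
  then have "s \<in> metric_interval z r"
    using metric_interval_trans(1)[of s r t z] trz metric_interval_sym[of t r]
      metric_interval_sym[of z r] by simp
  moreover have "r \<in> metric_interval z s" using gates(3) sC by (simp add: is_gate_def)
  ultimately have "r = s" using metric_interval_antisym by blast
  then show ?thesis using s(1) by simp
qed

text \<open>The gate lies between \<open>x\<close> and a point of \<open>I \<inter> J\<close>, both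
  of which belong to the convex set \<open>J\<close>.\<close>

lemma is_gate_Int:
  assumes "interval_convex J" "I \<inter> J \<noteq> {}" "x \<in> J" "is_gate I x p"
  shows "is_gate (I \<inter> J) x p"
proof -
  obtain z where z: "z \<in> I" "z \<in> J" using assms(2) by blast
  then have "p \<in> J"
    using assms interval_convexD[OF assms(1,3) z(2)] by (auto simp: is_gate_def)
  then show ?thesis using assms(4) by (auto simp: is_gate_def)
qed

section \<open>Projections to intervals\<close>

lemma metric_interval_in_intervals [simp]: "metric_interval x y \<in> intervals"
  by (auto simp: intervals_def)

text \<open>Different endpoints may describe \<open>I\<close>, but each choice yields the gate of
  \<open>z\<close>, which is unique; so the description in \<open>interval_proj\<close> is well
  defined.\<close>

lemma is_gate_interval_proj:
  fixes z :: "'a::median_space"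
  assumes "I \<in> intervals"
  shows "is_gate I z (interval_proj I z)"
proof -
  obtain a b where I: "I = metric_interval a b" using assms by (auto simp: intervals_def)
  have "interval_proj I z = median a b z"
    unfolding interval_proj_def
  proof (rule the_equality)
    show "\<exists>x y. I = metric_interval x y \<and> median a b z = median x y z" using I by blast
  next
    fix p assume "\<exists>x y. I = metric_interval x y \<and> p = median x y z"
    then show "p = median a b z"
      using I is_gate_median is_gate_unique by metis
  qed
  then show ?thesis using I is_gate_median by simp
qed

lemma interval_proj_eqI:
  fixes z :: "'a::median_space"
  shows "I \<in> intervals \<Longrightarrow> is_gate I z p \<Longrightarrow> interval_proj I z = p"
  using is_gate_interval_proj is_gate_unique by blast

lemma interval_proj_in: "I \<in> intervals \<Longrightarrow> interval_proj I (z::'a::median_space) \<in> I"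
  using is_gate_interval_proj by (auto simp: is_gate_def)

lemma interval_convex_intervals: "I \<in> intervals \<Longrightarrow> interval_convex (I :: 'a::median_space set)"
  by (auto simp: intervals_def interval_convex_metric_interval)

text \<open>The endpoints of the intersection are the gates in \<open>I\<close> of the endpoints of
  \<open>J\<close>. A point of \<open>I \<inter> J\<close> is its own gate, so it lies between
  them.\<close>

lemma intervals_Int:
  fixes I J :: "'a::median_space set"
  assumes I: "I \<in> intervals" and J: "J \<in> intervals" and ne: "I \<inter> J \<noteq> {}"
  shows "I \<inter> J \<in> intervals"
proof -
  obtain c d where Jcd: "J = metric_interval c d" using J by (auto simp: intervals_def)
  have cv: "interval_convex I" "interval_convex J"
    using I J by (auto intro: interval_convex_intervals)
  let ?p = "interval_proj I c" and ?q = "interval_proj I d"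
  have "is_gate (I \<inter> J) c ?p" "is_gate (I \<inter> J) d ?q"
    using is_gate_Int[OF cv(2) ne] is_gate_interval_proj[OF I] Jcd by auto
  then have "metric_interval ?p ?q \<subseteq> I \<inter> J"
    using interval_convex_Int[OF cv] by (auto simp: is_gate_def interval_convex_def)
  moreover have "I \<inter> J \<subseteq> metric_interval ?p ?q"
    using is_gate_between[OF cv(1) is_gate_interval_proj[OF I] is_gate_interval_proj[OF I]]
      is_gate_self Jcd by blast
  ultimately have "I \<inter> J = metric_interval ?p ?q" by blast
  then show ?thesis by simp
qed

text \<open>A point between two points with gate \<open>p\<close> has its gate in
  \<open>metric_interval p p\<close>, a singleton.\<close>

lemma interval_convex_fibre:
  fixes p :: "'a::median_space"
  assumes "I \<in> intervals"
  shows "interval_convex {x. interval_proj I x = p}"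
  using is_gate_between[OF interval_convex_intervals[OF assms] is_gate_interval_proj[OF assms]
      is_gate_interval_proj[OF assms] is_gate_interval_proj[OF assms]]
  by (fastforce simp: interval_convex_def)

lemma continuous_on_interval_proj:
  fixes I :: "'a::median_space set"
  assumes "I \<in> intervals"
  shows "continuous_on S (interval_proj I)"
proof -
  have "1-lipschitz_on S (interval_proj I)"
    using is_gate_lipschitz[OF is_gate_interval_proj[OF assms] is_gate_interval_proj[OF assms]]
    by (intro lipschitz_onI) auto
  then show ?thesis by (rule lipschitz_on_continuous_on)
qed

section \<open>Helly's theorem and realisation of Roller points\<close>

text \<open>The set \<open>K\<close> absorbs one member of the family at each induction step, which
  reduces the claim to three convex sets.\<close>

lemma helly_median_aux:
  fixes K :: "'a::median_space set"
  assumes "finite \<C>" "interval_convex K" "K \<noteq> {}"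
    "\<And>C. C \<in> \<C> \<Longrightarrow> interval_convex C \<and> K \<inter> C \<noteq> {}"
    "\<And>C D. C \<in> \<C> \<Longrightarrow> D \<in> \<C> \<Longrightarrow> C \<inter> D \<noteq> {}"
  shows "K \<inter> \<Inter>\<C> \<noteq> {}"
  using assms
proof (induction \<C> arbitrary: K rule: finite_induct)
  case empty
  then show ?case by simp
next
  case (insert D \<C>)
  have D: "interval_convex D" "K \<inter> D \<noteq> {}" using insert.prems by auto
  have "(K \<inter> D) \<inter> C \<noteq> {}" if "C \<in> \<C>" for C
  proof -
    have C: "interval_convex C" "K \<inter> C \<noteq> {}" "D \<inter> C \<noteq> {}" using insert.prems that by auto
    \<comment> \<open>One point is taken from each pairwise intersection, so each of the three sets
      contains two of the points and therefore their median.\<close>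
    then obtain x y z where xyz: "x \<in> K" "x \<in> D" "y \<in> K" "y \<in> C" "z \<in> D" "z \<in> C"
      using D(2) by blast
    have "median x y z \<in> K" "median x y z \<in> C" "median x y z \<in> D"
      using median_in_intervals[of x y z] xyz C(1) D(1) insert.prems(1) interval_convexD by blast+
    then show ?thesis by blast
  qed
  then have "(K \<inter> D) \<inter> \<Inter>\<C> \<noteq> {}"
    using insert.prems D by (intro insert.IH) (auto intro: interval_convex_Int)
  then show ?case by (simp add: Int_assoc)
qed

lemma helly_median:
  fixes \<C> :: "'a::median_space set set"
  assumes "finite \<C>" "\<And>C. C \<in> \<C> \<Longrightarrow> interval_convex C"
    "\<And>C D. C \<in> \<C> \<Longrightarrow> D \<in> \<C> \<Longrightarrow> C \<inter> D \<noteq> {}"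
  shows "\<Inter>\<C> \<noteq> {}"
  using helly_median_aux[OF assms(1), of UNIV] assms(2,3)
  by (fastforce simp: interval_convex_def)

section \<open>Realising coordinates of Roller points\<close>

lemma roller_points_in: "\<xi> \<in> roller_points \<Longrightarrow> I \<in> intervals \<Longrightarrow> \<xi> I \<in> I"
  by (auto simp: roller_points_def)

lemma roller_point_pair:
  fixes \<xi> :: "'a::median_space set \<Rightarrow> 'a"
  assumes \<xi>: "\<xi> \<in> roller_points" and I: "I \<in> intervals" and J: "J \<in> intervals"
  shows "\<exists>x. interval_proj I x = \<xi> I \<and> interval_proj J x = \<xi> J"
proof -
  define K where "K = metric_interval (\<xi> I) (\<xi> J)"
  have K: "K \<in> intervals" by (simp add: K_def)
  \<comment> \<open>Both \<open>I\<close> and \<open>J\<close> are instances of \<open>L\<close>. In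
    \<open>L \<inter> K\<close> the point \<open>\<xi> L\<close> is its own gate, so compatibility
    makes it the gate of \<open>\<xi> K\<close> there; by convexity of \<open>K\<close> this is also
    the gate in \<open>L\<close>.\<close>
  have "interval_proj L (\<xi> K) = \<xi> L" if L: "L \<in> intervals" "\<xi> L \<in> K" for L
  proof -
    have mem: "\<xi> L \<in> L \<inter> K" using L roller_points_in[OF \<xi>] by blast
    then have ne: "L \<inter> K \<noteq> {}" by blast
    note LK = intervals_Int[OF L(1) K ne]
    have "interval_proj (L \<inter> K) (\<xi> K) = interval_proj (L \<inter> K) (\<xi> L)"
      using \<xi> L K ne by (simp add: roller_points_def)
    also have "\<dots> = \<xi> L"
      using interval_proj_eqI[OF LK is_gate_self[OF mem]] .
    finally have "interval_proj (L \<inter> K) (\<xi> K) = \<xi> L" .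
    moreover have "is_gate (L \<inter> K) (\<xi> K) (interval_proj L (\<xi> K))"
      by (rule is_gate_Int[OF interval_convex_intervals[OF K] ne roller_points_in[OF \<xi> K]
            is_gate_interval_proj[OF L(1)]])
    ultimately show ?thesis using interval_proj_eqI[OF LK] by simp
  qed
  then show ?thesis using I J by (intro exI[of _ "\<xi> K"]) (auto simp: K_def)
qed

lemma roller_point_finite:
  fixes \<xi> :: "'a::median_space set \<Rightarrow> 'a"
  assumes \<xi>: "\<xi> \<in> roller_points" and "finite \<F>" "\<F> \<subseteq> intervals"
  obtains x where "\<And>I. I \<in> \<F> \<Longrightarrow> interval_proj I x = \<xi> I"
proof -
  have "\<Inter>((\<lambda>I. {x. interval_proj I x = \<xi> I}) ` \<F>) \<noteq> {}"
    using assms roller_point_pair[OF \<xi>]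
    by (intro helly_median) (auto intro!: interval_convex_fibre, blast)
  then show ?thesis using that by auto
qed

lemma roller_embedding_in_roller_points:
  "roller_embedding (x::'a::median_space) \<in> roller_points"
proof -
  have "interval_proj (I \<inter> J) (interval_proj I x) = interval_proj (I \<inter> J) (interval_proj J x)"
    if "I \<in> intervals" "J \<in> intervals" "I \<inter> J \<noteq> {}" for I J :: "'a set"
  proof -
    note IJ = intervals_Int[OF that]
    \<comment> \<open>Projecting first to a larger interval does not change the projection to
      \<open>I \<inter> J\<close>, so both sides reduce to projecting \<open>x\<close>
      directly.\<close>
    have "interval_proj (I \<inter> J) (interval_proj L x) = interval_proj (I \<inter> J) x"
      if "L \<in> intervals" "I \<inter> J \<subseteq> L" for L
      using is_gate_trans[OF is_gate_interval_proj[OF that(1)] is_gate_interval_proj[OF IJ] that(2)]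
        interval_proj_eqI[OF IJ] by metis
    then show ?thesis using that by simp
  qed
  then show ?thesis
    by (auto simp: roller_points_def roller_embedding_def interval_proj_in)
qed

section \<open>Topology of the Roller compactification\<close>

lemma topspace_roller:
  "topspace (roller_compactification :: ('a::median_space set \<Rightarrow> 'a) topology) = roller_points"
  by (auto simp: roller_compactification_def roller_points_def)

lemma continuous_map_roller_coordinate:
  assumes "I \<in> intervals"
  shows "continuous_map (roller_compactification :: ('a::median_space set \<Rightarrow> 'a) topology)
           euclidean (\<lambda>\<xi>. \<xi> I)"
  unfolding roller_compactification_def
  using continuous_map_product_projection[OF assms, of "\<lambda>I. top_of_set I"]
  by (intro continuous_map_from_subtopology) (simp add: continuous_map_in_subtopology)

text \<open>Tychonoff's theorem makes the product compact; each compatibility condition equates two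
  continuous maps into a Hausdorff space, so it is closed.\<close>

lemma compact_space_roller:
  assumes "compact_intervals TYPE('a::median_space)"
  shows "compact_space (roller_compactification :: ('a set \<Rightarrow> 'a) topology)"
proof -
  let ?P = "product_topology (\<lambda>I. top_of_set I) (intervals :: 'a set set)"
  let ?pairs = "{(I, J). I \<in> intervals \<and> J \<in> intervals \<and> I \<inter> J \<noteq> ({} :: 'a set)}"
  have compact: "compact_space ?P"
    using assms by (auto simp: compact_space_product_topology compact_space_subtopology
        compact_intervals_def intervals_def)
  have "closedin ?P {\<xi> \<in> topspace ?P.
      interval_proj (I \<inter> J) (\<xi> I) = interval_proj (I \<inter> J) (\<xi> J)}"
    if "I \<in> intervals" "J \<in> intervals" "I \<inter> J \<noteq> {}" for I J
  proof -
    have "continuous_map ?P euclidean (\<lambda>\<xi>. interval_proj (I \<inter> J) (\<xi> L))"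
      if "L \<in> intervals" for L
      using continuous_map_compose[OF continuous_map_product_projection[OF that, of "\<lambda>I. top_of_set I"],
          of euclidean "interval_proj (I \<inter> J)"]
        continuous_on_interval_proj[OF intervals_Int[OF \<open>I \<in> intervals\<close> \<open>J \<in> intervals\<close> \<open>I \<inter> J \<noteq> {}\<close>]]
      by (simp add: o_def)
    then show ?thesis
      using that by (intro closedin_continuous_maps_eq[where Y = euclidean]) auto
  qed
  \<comment> \<open>The intersection below is closed in the product because its index set is
    nonempty: every singleton is an interval, and \<open>undefined\<close> is just some
    point.\<close>
  moreover have "({undefined}, {undefined}) \<in> ?pairs"
    using metric_interval_in_intervals[of undefined undefined] by simp
  ultimately have "closedin ?P (\<Inter>(I, J)\<in>?pairs. {\<xi> \<in> topspace ?P.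
      interval_proj (I \<inter> J) (\<xi> I) = interval_proj (I \<inter> J) (\<xi> J)})"
    by (intro closedin_INT) auto
  moreover have "(\<Inter>(I, J)\<in>?pairs. {\<xi> \<in> topspace ?P.
      interval_proj (I \<inter> J) (\<xi> I) = interval_proj (I \<inter> J) (\<xi> J)}) = roller_points"
    using \<open>({undefined}, {undefined}) \<in> ?pairs\<close> by (auto simp: roller_points_def)
  ultimately show ?thesis
    using compact unfolding roller_compactification_def
    by (metis closedin_compact_space compact_space_subtopology)
qed

lemma roller_embedding_dense:
  "(roller_compactification :: ('a::median_space set \<Rightarrow> 'a) topology) closure_of
     range roller_embedding = roller_points"
proof (intro equalityI subsetI)
  fix \<xi> :: "'a set \<Rightarrow> 'a" assume \<xi>: "\<xi> \<in> roller_points"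
  have "\<exists>\<eta>. \<eta> \<in> range roller_embedding \<and> \<eta> \<in> T"
    if T: "\<xi> \<in> T" "openin roller_compactification T" for T
  proof -
    obtain V where V: "openin (product_topology (\<lambda>I. top_of_set I) intervals) V"
      "T = V \<inter> roller_points"
      using T by (auto simp: roller_compactification_def openin_subtopology)
    then obtain U where U: "finite {I \<in> intervals. U I \<noteq> topspace (top_of_set I)}"
      "\<xi> \<in> Pi\<^sub>E intervals U" "Pi\<^sub>E intervals U \<subseteq> V"
      using T V(1)[unfolded openin_product_topology_alt, rule_format, of \<xi>] by auto
    \<comment> \<open>The basic open set constrains only finitely many coordinates, and these can be
      matched exactly by a point of the space.\<close>
    obtain x where x: "\<And>I. I \<in> {I \<in> intervals. U I \<noteq> topspace (top_of_set I)} \<Longrightarrow>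
        interval_proj I x = \<xi> I"
      using roller_point_finite[OF \<xi> U(1)] by auto
    have "roller_embedding x I \<in> U I" if "I \<in> intervals" for I
    proof (cases "U I = I")
      case True
      then show ?thesis using that interval_proj_in[OF that] by (simp add: roller_embedding_def)
    next
      case False
      then have "interval_proj I x = \<xi> I" using x that by simp
      then show ?thesis using U(2) that by (auto simp: roller_embedding_def)
    qed
    then have "roller_embedding x \<in> Pi\<^sub>E intervals U"
      by (auto simp: roller_embedding_def)
    then show ?thesis
      using U(3) V(2) roller_embedding_in_roller_points by blast
  qed
  then show "\<xi> \<in> roller_compactification closure_of range roller_embedding"
    using \<xi> by (simp add: in_closure_of topspace_roller)
qed (metis closure_of_subset_topspace subsetD topspace_roller)

section \<open>The homeomorphism\<close>

definition roller_busemann ::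
  "'a::median_space \<Rightarrow> ('a set \<Rightarrow> 'a) \<Rightarrow> 'a \<Rightarrow> real" where
  "roller_busemann x\<^sub>0 \<xi> =
     (\<lambda>y. dist (\<xi> (metric_interval x\<^sub>0 y)) y - dist (\<xi> (metric_interval x\<^sub>0 y)) x\<^sub>0)"

text \<open>The gate lies between \<open>x\<close> and both endpoints, so its distance to
  \<open>x\<close> cancels. Only one coordinate of \<open>\<xi>\<close> is compared, hence
  \<open>x\<close> may disagree with the others.\<close>

lemma roller_busemann_eq:
  fixes x :: "'a::median_space"
  assumes "\<xi> (metric_interval x\<^sub>0 y) = interval_proj (metric_interval x\<^sub>0 y) x"
  shows "roller_busemann x\<^sub>0 \<xi> y = busemann_embedding x\<^sub>0 x y"
proof -
  have "is_gate (metric_interval x\<^sub>0 y) x (\<xi> (metric_interval x\<^sub>0 y))"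
    unfolding assms by (intro is_gate_interval_proj) simp
  then have "\<xi> (metric_interval x\<^sub>0 y) \<in> metric_interval x y"
    "\<xi> (metric_interval x\<^sub>0 y) \<in> metric_interval x x\<^sub>0"
    by (auto simp: is_gate_def)
  then show ?thesis
    by (simp add: roller_busemann_def busemann_embedding_def metric_interval_iff)
qed

lemma roller_busemann_embedding:
  "roller_busemann x\<^sub>0 (roller_embedding x) = busemann_embedding x\<^sub>0 x"
  by (rule ext, rule roller_busemann_eq) (simp add: roller_embedding_def)

lemma busemann_embedding_in_lip_functions: "busemann_embedding x\<^sub>0 x \<in> lip_functions x\<^sub>0"
  unfolding lip_functions_def busemann_embedding_def
  by (auto intro!: lipschitz_onI simp: dist_real_def abs_le_iff)
    (metis dist_commute dist_triangle add.commute diff_le_eq)+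

text \<open>Every relation between finitely many values of a Busemann function passes to the
  Roller points.\<close>

lemma roller_busemann_finite:
  fixes \<xi> :: "'a::median_space set \<Rightarrow> 'a"
  assumes "\<xi> \<in> roller_points" "finite \<F>" "\<F> \<subseteq> intervals" "finite Y"
  obtains x where "\<And>y. y \<in> Y \<Longrightarrow> roller_busemann x\<^sub>0 \<xi> y = busemann_embedding x\<^sub>0 x y"
    "\<And>I. I \<in> \<F> \<Longrightarrow> interval_proj I x = \<xi> I"
proof -
  \<comment> \<open>The value at \<open>y\<close> reads only the coordinate at
    \<open>metric_interval x\<^sub>0 y\<close>, so these intervals join \<open>\<F>\<close>.\<close>
  obtain x where x: "\<And>I. I \<in> \<F> \<union> metric_interval x\<^sub>0 ` Y \<Longrightarrow> interval_proj I x = \<xi> I"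
    using roller_point_finite[OF assms(1), of "\<F> \<union> metric_interval x\<^sub>0 ` Y"] assms(2-)
    by (metis Un_least finite_UnI finite_imageI image_subsetI metric_interval_in_intervals)
  show ?thesis
    by (rule that[of x]) (auto intro!: roller_busemann_eq simp: x)
qed

lemma roller_busemann_in_lip_functions:
  fixes \<xi> :: "'a::median_space set \<Rightarrow> 'a"
  assumes \<xi>: "\<xi> \<in> roller_points"
  shows "roller_busemann x\<^sub>0 \<xi> \<in> lip_functions x\<^sub>0"
proof -
  have "dist (roller_busemann x\<^sub>0 \<xi> y) (roller_busemann x\<^sub>0 \<xi> z) \<le> dist y z" for y z
  proof -
    obtain x where x: "\<And>v. v \<in> {y, z} \<Longrightarrow> roller_busemann x\<^sub>0 \<xi> v = busemann_embedding x\<^sub>0 x v"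
      using roller_busemann_finite[OF \<xi>, of "{}" "{y, z}"] by auto
    have "1-lipschitz_on UNIV (busemann_embedding x\<^sub>0 x)"
      using busemann_embedding_in_lip_functions by (auto simp: lip_functions_def)
    then have "dist (busemann_embedding x\<^sub>0 x y) (busemann_embedding x\<^sub>0 x z) \<le> dist y z"
      using lipschitz_onD by fastforce
    then show ?thesis by (simp add: x)
  qed
  \<comment> \<open>Normalisation: the interval from \<open>x\<^sub>0\<close> to itself is a
    singleton, which leaves no choice for the coordinate.\<close>
  moreover have "\<xi> {x\<^sub>0} = x\<^sub>0"
    using roller_points_in[OF \<xi> metric_interval_in_intervals[of x\<^sub>0 x\<^sub>0]] by simp
  ultimately show ?thesis
    by (auto simp: lip_functions_def roller_busemann_def intro!: lipschitz_onI)
qed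

lemma inj_on_roller_busemann: "inj_on (roller_busemann (x\<^sub>0::'a::median_space)) roller_points"
proof (rule inj_onI)
  fix \<xi> \<eta> :: "'a set \<Rightarrow> 'a"
  assume \<xi>: "\<xi> \<in> roller_points" and \<eta>: "\<eta> \<in> roller_points"
    and eq: "roller_busemann x\<^sub>0 \<xi> = roller_busemann x\<^sub>0 \<eta>"
  \<comment> \<open>Hence the function attains its minimum over \<open>I\<close> exactly at
    \<open>\<zeta> I\<close>, so the function determines the coordinate.\<close>
  have diff: "roller_busemann x\<^sub>0 \<zeta> w - roller_busemann x\<^sub>0 \<zeta> (\<zeta> I) = dist (\<zeta> I) w"
    if \<zeta>: "\<zeta> \<in> roller_points" and I: "I \<in> intervals" "w \<in> I" for \<zeta> I and w :: 'a
  proof -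
    obtain x where x: "\<And>y. y \<in> {w, \<zeta> I} \<Longrightarrow> roller_busemann x\<^sub>0 \<zeta> y = busemann_embedding x\<^sub>0 x y"
      "interval_proj I x = \<zeta> I"
      using roller_busemann_finite[OF \<zeta>, of "{I}" "{w, \<zeta> I}"] I by auto
    then have "\<zeta> I \<in> metric_interval x w"
      using is_gate_interval_proj[OF I(1), of x] I(2) by (simp add: is_gate_def)
    then show ?thesis
      using x(1) by (simp add: busemann_embedding_def metric_interval_iff)
  qed
  show "\<xi> = \<eta>"
  proof (rule ext)
    fix I :: "'a set"
    show "\<xi> I = \<eta> I"
    proof (cases "I \<in> intervals")
      case True
      \<comment> \<open>Taking for \<open>w\<close> the other point's coordinate, the two
        differences are negatives of each other because the functions agree.\<close>
      then have "dist (\<xi> I) (\<eta> I) = - dist (\<eta> I) (\<xi> I)"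
        using diff[OF \<xi> True, of "\<eta> I"] diff[OF \<eta> True, of "\<xi> I"] eq
          roller_points_in[OF \<xi> True] roller_points_in[OF \<eta> True] by simp
      then show ?thesis by (simp add: dist_commute)
    next
      case False
      then show ?thesis
        using \<xi> \<eta> by (auto simp: roller_points_def PiE_def extensional_def)
    qed
  qed
qed

lemma Hausdorff_space_lip_topology: "Hausdorff_space (lip_topology x\<^sub>0)"
  by (simp add: lip_topology_def Hausdorff_space_subtopology Hausdorff_space_product_topology)

lemma continuous_map_roller_busemann:
  "continuous_map roller_compactification (lip_topology x\<^sub>0)
     (roller_busemann (x\<^sub>0 :: 'a::median_space))"
proof -
  have "continuous_map roller_compactification euclideanreal (\<lambda>\<xi>. roller_busemann x\<^sub>0 \<xi> y)" for y
  proof -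
    have "continuous_map roller_compactification euclideanreal
        ((\<lambda>p. dist p y - dist p x\<^sub>0) \<circ> (\<lambda>\<xi>. \<xi> (metric_interval x\<^sub>0 y)))"
      by (rule continuous_map_compose[OF continuous_map_roller_coordinate])
        (auto intro!: continuous_intros)
    then show ?thesis by (simp add: o_def roller_busemann_def)
  qed
  then show ?thesis
    unfolding lip_topology_def continuous_map_in_subtopology
    by (auto simp: continuous_map_componentwise_UNIV topspace_roller
        roller_busemann_in_lip_functions)
qed

text \<open>Density and continuity give one inclusion. For the other, the image is compact in a
  Hausdorff space, hence closed, and it contains the range of
  \<open>busemann_embedding x\<^sub>0\<close>.\<close>

lemma roller_busemann_image:
  assumes "compact_intervals TYPE('a::median_space)"
  shows "roller_busemann x\<^sub>0 ` roller_points =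
    lip_topology (x\<^sub>0 :: 'a) closure_of range (busemann_embedding x\<^sub>0)"
proof
  have range: "range (busemann_embedding x\<^sub>0) = roller_busemann x\<^sub>0 ` range roller_embedding"
    by (auto simp: image_image roller_busemann_embedding)
  show "roller_busemann x\<^sub>0 ` roller_points \<subseteq>
      lip_topology x\<^sub>0 closure_of range (busemann_embedding x\<^sub>0)"
    unfolding range roller_embedding_dense[symmetric]
    by (rule continuous_map_image_closure_subset[OF continuous_map_roller_busemann])
  have "compactin (lip_topology x\<^sub>0) (roller_busemann x\<^sub>0 ` roller_points)"
    using image_compactin[OF _ continuous_map_roller_busemann] compact_space_roller[OF assms]
    by (metis compact_space_def topspace_roller)
  then have "closedin (lip_topology x\<^sub>0) (roller_busemann x\<^sub>0 ` roller_points)"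
    using compactin_imp_closedin Hausdorff_space_lip_topology by blast
  then show "lip_topology x\<^sub>0 closure_of range (busemann_embedding x\<^sub>0) \<subseteq>
      roller_busemann x\<^sub>0 ` roller_points"
    using roller_embedding_in_roller_points unfolding range by (intro closure_of_minimal) auto
qed

theorem proposition4p21:
  fixes x\<^sub>0 :: "'a::median_space"
  assumes "complete (UNIV :: 'a set)"
    and "locally_interval_convex TYPE('a)"
    and "compact_intervals TYPE('a)"
  shows "\<exists>\<Phi>. homeomorphic_map (roller_compactification :: ('a set \<Rightarrow> 'a) topology)
                (busemann_compactification x\<^sub>0) \<Phi>
            \<and> (\<forall>x::'a. \<Phi> (roller_embedding x) = busemann_embedding x\<^sub>0 x)"
proof (intro exI conjI allI)
  note image = roller_busemann_image[OF assms(3), of x\<^sub>0]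
  show "homeomorphic_map roller_compactification (busemann_compactification x\<^sub>0)
      (roller_busemann x\<^sub>0)"
  proof (rule continuous_imp_homeomorphic_map)
    show "continuous_map roller_compactification (busemann_compactification x\<^sub>0)
        (roller_busemann x\<^sub>0)"
      unfolding busemann_compactification_def continuous_map_in_subtopology
      using continuous_map_roller_busemann image by (auto simp: topspace_roller)
    show "compact_space (roller_compactification :: ('a set \<Rightarrow> 'a) topology)"
      by (rule compact_space_roller[OF assms(3)])
    show "Hausdorff_space (busemann_compactification x\<^sub>0)"
      by (simp add: busemann_compactification_def Hausdorff_space_subtopology
          Hausdorff_space_lip_topology)
    show "roller_busemann x\<^sub>0 ` topspace roller_compactification =
        topspace (busemann_compactification x\<^sub>0)"
      using image closure_of_subset_topspace[of "lip_topology x\<^sub>0"]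
      by (auto simp: busemann_compactification_def topspace_roller)
    show "inj_on (roller_busemann x\<^sub>0) (topspace roller_compactification)"
      by (simp add: topspace_roller inj_on_roller_busemann)
  qed
  show "roller_busemann x\<^sub>0 (roller_embedding x) = busemann_embedding x\<^sub>0 x" for x
    by (rule roller_busemann_embedding)
qed

end
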